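(* There exist a Hilbert $C^*$-module $N$ over $A=C[0,1]$ and closed submodules $K\subset M\subset N$ such that $K$ is thick in $M$, $M$ is thick in $N$, but $K$ is not thick in $N$.
   Context: For a Hilbert $C^*$-module $N$ with inner product $\langle\cdot,\cdot\rangle$, a closed submodule $M\subset N$ is called thick in $N$ if $M^\perp=\{n\in N:\langle n,m\rangle=0\ \forall m\in M\}=0$. A closed submodule $M$ of $N$ is regarded as a Hilbert $C^*$-module with the inner product restricted from $N$. *)

theory Defs
  imports "HOL-Analysis.Analysis" "HOL-Algebra.Module"
begin

section \<open>The C*-algebra \<open>C[0,1]\<close>\<close>

text \<open>
  Complex-valued continuous functions on the unit interval, with pointwise operations.  Functions
  are \<^const>\<open>extensional\<close>, so equality in the carrier is equality on \<open>{0..1}\<close>.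
\<close>

definition C01 :: "(real \<Rightarrow> complex) ring" where
  "C01 = \<lparr>carrier = {f. continuous_on {0..1} f \<and> f \<in> extensional {0..1}},
          mult = (\<lambda>f g. \<lambda>t\<in>{0..1}. f t * g t),
          one = (\<lambda>t\<in>{0..1}. 1),
          zero = (\<lambda>t\<in>{0..1}. 0),
          add = (\<lambda>f g. \<lambda>t\<in>{0..1}. f t + g t)\<rparr>"

definition star01 :: "(real \<Rightarrow> complex) \<Rightarrow> real \<Rightarrow> complex" where
  "star01 f = (\<lambda>t\<in>{0..1}. cnj (f t))"

definition norm01 :: "(real \<Rightarrow> complex) \<Rightarrow> real" where
  "norm01 f = (SUP t\<in>{0..1}. cmod (f t))"

definition positive01 :: "(real \<Rightarrow> complex) \<Rightarrow> bool" where
  "positive01 f \<longleftrightarrow> f \<in> carrier C01 \<and> (\<forall>t\<in>{0..1}. f t \<in> \<real>\<^sub>\<ge>\<^sub>0)"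


section \<open>Hilbert C*-modules over \<open>C[0,1]\<close>\<close>

record ('a, 'b) ip_module = "('a, 'b) module" +
  ip :: "'b \<Rightarrow> 'b \<Rightarrow> 'a"

definition hm_norm :: "(real \<Rightarrow> complex, 'b, 'm) ip_module_scheme \<Rightarrow> 'b \<Rightarrow> real" where
  "hm_norm N x = sqrt (norm01 (ip N x x))"

text \<open>
  The locale \<^locale>\<open>Metric_space\<close> asks for symmetry and nonnegativity of the distance on the whole
  type; hence the value 0 off the carrier, which does not affect the topology.
\<close>

definition hm_dist :: "(real \<Rightarrow> complex, 'b, 'm) ip_module_scheme \<Rightarrow> 'b \<Rightarrow> 'b \<Rightarrow> real" where
  "hm_dist N x y =
     (if x \<in> carrier N \<and> y \<in> carrier N then hm_norm N (x \<ominus>\<^bsub>N\<^esub> y) else 0)"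

definition hm_topology :: "(real \<Rightarrow> complex, 'b, 'm) ip_module_scheme \<Rightarrow> 'b topology" where
  "hm_topology N = Metric_space.mtopology (carrier N) (hm_dist N)"

text \<open>
  As \<open>C[0,1]\<close> is commutative and unital, right modules are modules in the sense of
  \<^locale>\<open>Module.module\<close>, and the complex scalars act through the constant functions.  The inner
  product is linear in the second argument.
\<close>

locale pre_hilbert_module = Module.module C01 N
  for N :: "(real \<Rightarrow> complex, 'b, 'm) ip_module_scheme" (structure) +
  assumes ip_closed: "\<lbrakk>x \<in> carrier N; y \<in> carrier N\<rbrakk> \<Longrightarrow> ip N x y \<in> carrier C01"
    and ip_add: "\<lbrakk>x \<in> carrier N; y \<in> carrier N; z \<in> carrier N\<rbrakk> \<Longrightarrow>
          ip N x (y \<oplus> z) = ip N x y \<oplus>\<^bsub>C01\<^esub> ip N x z"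
    and ip_smult: "\<lbrakk>a \<in> carrier C01; x \<in> carrier N; y \<in> carrier N\<rbrakk> \<Longrightarrow>
          ip N x (a \<odot> y) = ip N x y \<otimes>\<^bsub>C01\<^esub> a"
    and ip_star: "\<lbrakk>x \<in> carrier N; y \<in> carrier N\<rbrakk> \<Longrightarrow> ip N y x = star01 (ip N x y)"
    and ip_positive: "x \<in> carrier N \<Longrightarrow> positive01 (ip N x x)"
    and ip_definite: "\<lbrakk>x \<in> carrier N; ip N x x = \<zero>\<^bsub>C01\<^esub>\<rbrakk> \<Longrightarrow> x = \<zero>"

locale hilbert_module = pre_hilbert_module +
  assumes complete: "Metric_space.mcomplete (carrier N) (hm_dist N)"

definition closed_submodule :: "'b set \<Rightarrow> (real \<Rightarrow> complex, 'b, 'm) ip_module_scheme \<Rightarrow> bool" where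
  "closed_submodule M N \<longleftrightarrow> submodule M C01 N \<and> closedin (hm_topology N) M"

definition restrict_module ::
    "(real \<Rightarrow> complex, 'b, 'm) ip_module_scheme \<Rightarrow> 'b set \<Rightarrow> (real \<Rightarrow> complex, 'b, 'm) ip_module_scheme"
  where "restrict_module N M = N\<lparr>carrier := M\<rparr>"

definition orth_compl :: "'b set \<Rightarrow> (real \<Rightarrow> complex, 'b, 'm) ip_module_scheme \<Rightarrow> 'b set" where
  "orth_compl M N = {n \<in> carrier N. \<forall>m\<in>M. ip N n m = \<zero>\<^bsub>C01\<^esub>}"

definition thick :: "'b set \<Rightarrow> (real \<Rightarrow> complex, 'b, 'm) ip_module_scheme \<Rightarrow> bool" where
  "thick M N \<longleftrightarrow> orth_compl M N = {\<zero>\<^bsub>N\<^esub>}"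

end

theory Submission
  imports Defs
begin

text \<open>
  Let \<open>N\<close> be the standard Hilbert module of uniformly square summable sequences
  \<open>x = (x\<^sub>0, x\<^sub>1, \<dots>)\<close> in \<open>C[0,1]\<close>, and let \<open>q\<^sub>0, q\<^sub>1, \<dots>\<close> be dense in \<open>[0,1]\<close>.  Put

    \<open>M = {x. \<forall>k. x\<^sub>k\<^sub>+\<^sub>1(q\<^sub>k) = 2\<^sup>-\<^sup>(\<^sup>k\<^sup>+\<^sup>1\<^sup>) x\<^sub>0(q\<^sub>k)}\<close>  and  \<open>K = {x. x\<^sub>0 = 0 \<and> (\<forall>k. x\<^sub>k\<^sub>+\<^sub>1(q\<^sub>k) = 0)} \<subseteq> M\<close>.

  The idea is to let \<open>K\<close>, within the module of all \<open>x\<close> with \<open>x\<^sub>0 = 0\<close>, miss one direction in the fibre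
  over each point \<open>q\<^sub>k\<close>, a different direction for each \<open>k\<close>.  A single missing direction at
  a single point is invisible to orthogonality, because inner products are continuous: if \<open>h \<bottom> K\<close>, then \<open>h\<^sub>k\<^sub>+\<^sub>1\<close> is orthogonal to all \<open>f\<close> with \<open>f(q\<^sub>k) = 0\<close>,
  so it vanishes off \<open>q\<^sub>k\<close> and hence everywhere (lemma \<open>coordinate_zero_if_orthogonal\<close>).  Thus the
  orthogonal complement of \<open>K\<close> consists of the sequences \<open>(h\<^sub>0, 0, 0, \<dots>)\<close>, and it is not zero.  The
  points together are dense, however, and this is visible to membership:

  \<^item> If such an \<open>h\<close> lies in \<open>M\<close>, then \<open>h\<^sub>0(q\<^sub>k) = 0\<close> for all \<open>k\<close>, so \<open>h = 0\<close>: \<open>K\<close> is thick in \<open>M\<close>.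

  \<^item> If such an \<open>h\<close> is orthogonal to \<open>M\<close>, then it is orthogonal to the element \<open>(1, 1/2, 1/4, \<dots>)\<close> of
    \<open>M\<close>, so \<open>h\<^sub>0 = 0\<close>: \<open>M\<close> is thick in \<open>N\<close>.

  Both \<open>M\<close> and \<open>K\<close> are cut out by linear equations between values of coordinates at points, and such
  values depend continuously on \<open>x\<close>; this makes them closed submodules (lemma
  \<open>closed_submodule_constrained\<close>).  The analytic work is to show that \<open>N\<close> is a Hilbert module.
  There the norm is controlled by the Euclidean norms of finitely many coordinates at a point (lemma
  \<open>hm_norm_le_iff\<close>), so that the triangle inequality and completeness follow from finite sums.
\<close>

section \<open>Uniformly convergent series\<close>

text \<open>
  Cauchy's criterion.  It does not mention the sum of the series, so it passes from a dominating
  series to a dominated one, and from the elements of a Cauchy sequence to their limit.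
\<close>

lemma uniformly_convergent_series_iff_tails:
  fixes f :: "nat \<Rightarrow> 'a \<Rightarrow> 'b::banach"
  shows "uniformly_convergent_on S (\<lambda>m t. \<Sum>n<m. f n t) \<longleftrightarrow>
    (\<forall>e>0. \<exists>m0. \<forall>t\<in>S. \<forall>m\<ge>m0. \<forall>p. norm (\<Sum>n\<in>{m..<p}. f n t) < e)"
    (is "?conv \<longleftrightarrow> ?tails")
proof -
  have diff: "norm (\<Sum>n\<in>{m..<p}. f n t) = dist (\<Sum>n<m. f n t) (\<Sum>n<p. f n t)" if "m \<le> p" for m p t
  proof -
    have "(\<Sum>n<p. f n t) = (\<Sum>n<m. f n t) + (\<Sum>n\<in>{m..<p}. f n t)"
      using that by (subst sum.union_disjoint [symmetric]) (auto intro!: sum.cong)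
    then show ?thesis
      by (simp add: dist_norm norm_minus_commute)
  qed
  show ?thesis
    unfolding uniformly_convergent_eq_Cauchy
  proof
    assume C: "uniformly_Cauchy_on S (\<lambda>m t. \<Sum>n<m. f n t)"
    show ?tails
    proof (intro allI impI)
      fix e :: real
      assume "e > 0"
      then obtain m0 where m0: "\<And>t m p. \<lbrakk>t \<in> S; m \<ge> m0; p \<ge> m0\<rbrakk> \<Longrightarrow>
          dist (\<Sum>n<m. f n t) (\<Sum>n<p. f n t) < e"
        using C unfolding uniformly_Cauchy_on_def by meson
      have "norm (\<Sum>n\<in>{m..<p}. f n t) < e" if "t \<in> S" "m \<ge> m0" for t m p
        using that m0 [of t m p] diff [of m p t] \<open>e > 0\<close> by (cases "m \<le> p") auto
      then show "\<exists>m0. \<forall>t\<in>S. \<forall>m\<ge>m0. \<forall>p. norm (\<Sum>n\<in>{m..<p}. f n t) < e"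
        by blast
    qed
  next
    assume ?tails
    then show "uniformly_Cauchy_on S (\<lambda>m t. \<Sum>n<m. f n t)"
      by (intro uniformly_Cauchy_onI') (metis diff less_imp_le)
  qed
qed

lemma uniformly_convergent_series_comparison:
  fixes f :: "nat \<Rightarrow> 'a \<Rightarrow> 'b::banach" and g :: "nat \<Rightarrow> 'a \<Rightarrow> real"
  assumes g: "uniformly_convergent_on S (\<lambda>m t. \<Sum>n<m. g n t)"
    and le: "\<And>n t. t \<in> S \<Longrightarrow> norm (f n t) \<le> g n t"
  shows "uniformly_convergent_on S (\<lambda>m t. \<Sum>n<m. f n t)"
  unfolding uniformly_convergent_series_iff_tails
proof (intro allI impI)
  fix e :: real
  assume "e > 0"
  with g obtain m0 where m0: "\<And>t m p. \<lbrakk>t \<in> S; m \<ge> m0\<rbrakk> \<Longrightarrow> norm (\<Sum>n\<in>{m..<p}. g n t) < e"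
    unfolding uniformly_convergent_series_iff_tails by meson
  have "norm (\<Sum>n\<in>{m..<p}. f n t) < e" if "t \<in> S" "m \<ge> m0" for t m p
    using sum_norm_le [of "{m..<p}" "\<lambda>n. f n t" "\<lambda>n. g n t"] le m0 [of t m p] that
    by fastforce
  then show "\<exists>m0. \<forall>t\<in>S. \<forall>m\<ge>m0. \<forall>p. norm (\<Sum>n\<in>{m..<p}. f n t) < e"
    by blast
qed


section \<open>The ring \<open>C[0,1]\<close>\<close>

lemma C01_eqI:
  "\<lbrakk>f \<in> carrier C01; g \<in> carrier C01; \<And>t. t \<in> {0..1} \<Longrightarrow> f t = g t\<rbrakk> \<Longrightarrow> f = g"
  by (auto simp: C01_def intro: extensionalityI)

lemma C01_ops [simp]:
  assumes "t \<in> {0..1}"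
  shows "(f \<otimes>\<^bsub>C01\<^esub> g) t = f t * g t" "(f \<oplus>\<^bsub>C01\<^esub> g) t = f t + g t"
    "\<one>\<^bsub>C01\<^esub> t = 1" "\<zero>\<^bsub>C01\<^esub> t = 0"
  using assms by (auto simp: C01_def)

lemma C01_continuous: "f \<in> carrier C01 \<Longrightarrow> continuous_on {0..1} f"
  by (simp add: C01_def)

lemma restrict_in_C01_iff:
  "restrict f {0..1} \<in> carrier C01 \<longleftrightarrow> continuous_on {0..1} f"
  by (simp add: C01_def cong: continuous_on_cong_simp)

lemma C01_closed [simp]:
  "\<lbrakk>f \<in> carrier C01; g \<in> carrier C01\<rbrakk> \<Longrightarrow> f \<otimes>\<^bsub>C01\<^esub> g \<in> carrier C01"
  "\<lbrakk>f \<in> carrier C01; g \<in> carrier C01\<rbrakk> \<Longrightarrow> f \<oplus>\<^bsub>C01\<^esub> g \<in> carrier C01"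
  "\<one>\<^bsub>C01\<^esub> \<in> carrier C01" "\<zero>\<^bsub>C01\<^esub> \<in> carrier C01"
  by (auto simp: C01_def simp flip: atLeastAtMost_iff cong: continuous_on_cong_simp intro!: continuous_intros)

lemma cring_C01: "cring C01"
proof (rule cringI)
  show "abelian_group C01"
  proof (rule abelian_groupI)
    fix f
    assume f: "f \<in> carrier C01"
    have uminus: "(\<lambda>t\<in>{0..1}. - f t) \<in> carrier C01"
      unfolding restrict_in_C01_iff by (intro continuous_intros C01_continuous f)
    moreover have "(\<lambda>t\<in>{0..1}. - f t) \<oplus>\<^bsub>C01\<^esub> f = \<zero>\<^bsub>C01\<^esub>"
      using f uminus by (intro C01_eqI C01_closed) simp_all
    ultimately show "\<exists>g\<in>carrier C01. g \<oplus>\<^bsub>C01\<^esub> f = \<zero>\<^bsub>C01\<^esub>"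
      by blast
  qed (auto intro!: C01_eqI)
  show "comm_monoid C01"
    by (rule comm_monoidI) (auto intro!: C01_eqI)
qed (auto intro!: C01_eqI simp: algebra_simps)


section \<open>The standard Hilbert module\<close>

text \<open>
  Convergence is required to be uniform in \<open>t\<close>.  For continuous \<open>x n\<close> this is convergence of
  \<open>\<Sum>n. cnj (x n) * x n\<close> in the norm of \<open>C[0,1]\<close>, the usual condition for the standard module.
\<close>

definition square_summable01 :: "(nat \<Rightarrow> real \<Rightarrow> complex) \<Rightarrow> bool" where
  "square_summable01 x \<longleftrightarrow>
     uniformly_convergent_on {0..1} (\<lambda>m t. \<Sum>n<m. (cmod (x n t))\<^sup>2)"

definition l2_C01 :: "(real \<Rightarrow> complex, nat \<Rightarrow> real \<Rightarrow> complex) ip_module" where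
  "l2_C01 = \<lparr>carrier = {x. (\<forall>n. x n \<in> carrier C01) \<and> square_summable01 x},
            mult = (\<lambda>x y n. x n \<otimes>\<^bsub>C01\<^esub> y n),
            one = (\<lambda>n. \<one>\<^bsub>C01\<^esub>),
            zero = (\<lambda>n. \<zero>\<^bsub>C01\<^esub>),
            add = (\<lambda>x y n. x n \<oplus>\<^bsub>C01\<^esub> y n),
            smult = (\<lambda>a x n. a \<otimes>\<^bsub>C01\<^esub> x n),
            ip = (\<lambda>x y. \<lambda>t\<in>{0..1}. \<Sum>n. cnj (x n t) * y n t)\<rparr>"

lemma l2_C01_simps [simp]:
  "x \<in> carrier l2_C01 \<longleftrightarrow> (\<forall>n. x n \<in> carrier C01) \<and> square_summable01 x"
  "\<zero>\<^bsub>l2_C01\<^esub> = (\<lambda>n. \<zero>\<^bsub>C01\<^esub>)"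
  "x \<oplus>\<^bsub>l2_C01\<^esub> y = (\<lambda>n. x n \<oplus>\<^bsub>C01\<^esub> y n)"
  "a \<odot>\<^bsub>l2_C01\<^esub> x = (\<lambda>n. a \<otimes>\<^bsub>C01\<^esub> x n)"
  "ip l2_C01 x y = (\<lambda>t\<in>{0..1}. \<Sum>n. cnj (x n t) * y n t)"
  by (simp_all add: l2_C01_def)

lemma l2_C01_eqI:
  assumes "x \<in> carrier l2_C01" "y \<in> carrier l2_C01"
    and "\<And>n t. t \<in> {0..1} \<Longrightarrow> x n t = y n t"
  shows "x = y"
  using assms by (intro ext [of x y] C01_eqI) auto

lemma square_summable01_add:
  assumes x: "square_summable01 x" and y: "square_summable01 y"
  shows "square_summable01 (\<lambda>n. x n \<oplus>\<^bsub>C01\<^esub> y n)"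
  unfolding square_summable01_def
proof (rule uniformly_convergent_series_comparison)
  have "uniformly_convergent_on {0..1}
          (\<lambda>m t. 2 * ((\<Sum>n<m. (cmod (x n t))\<^sup>2) + (\<Sum>n<m. (cmod (y n t))\<^sup>2)))"
    using x y unfolding square_summable01_def
    by (intro bounded_linear.uniformly_convergent_on [OF bounded_linear_mult_right] uniformly_convergent_add)
  then show "uniformly_convergent_on {0..1}
          (\<lambda>m t. \<Sum>n<m. 2 * ((cmod (x n t))\<^sup>2 + (cmod (y n t))\<^sup>2))"
    by (simp only: sum.distrib flip: sum_distrib_left)
next
  fix n and t :: real
  assume "t \<in> {0..1}"
  have "(cmod (x n t + y n t))\<^sup>2 \<le> (cmod (x n t) + cmod (y n t))\<^sup>2"
    by (intro power_mono norm_triangle_ineq) simp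
  also have "\<dots> \<le> 2 * ((cmod (x n t))\<^sup>2 + (cmod (y n t))\<^sup>2)"
    using sum_squares_bound [of "cmod (x n t)" "cmod (y n t)"] by (simp add: power2_sum)
  finally show "norm ((cmod ((x n \<oplus>\<^bsub>C01\<^esub> y n) t))\<^sup>2) \<le> 2 * ((cmod (x n t))\<^sup>2 + (cmod (y n t))\<^sup>2)"
    using \<open>t \<in> {0..1}\<close> by simp
qed

lemma square_summable01_smult:
  assumes a: "a \<in> carrier C01" and x: "square_summable01 x"
  shows "square_summable01 (\<lambda>n. a \<otimes>\<^bsub>C01\<^esub> x n)"
proof -
  have "compact (a ` {0..1})"
    using a by (intro compact_continuous_image C01_continuous) auto
  then obtain B where B: "\<And>t. t \<in> {0..1} \<Longrightarrow> cmod (a t) \<le> B"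
    using compact_imp_bounded bounded_iff by (metis imageI)
  show ?thesis
    unfolding square_summable01_def
  proof (rule uniformly_convergent_series_comparison)
    have "uniformly_convergent_on {0..1} (\<lambda>m t. B\<^sup>2 * (\<Sum>n<m. (cmod (x n t))\<^sup>2))"
      using x unfolding square_summable01_def
      by (intro bounded_linear.uniformly_convergent_on [OF bounded_linear_mult_right])
    then show "uniformly_convergent_on {0..1} (\<lambda>m t. \<Sum>n<m. B\<^sup>2 * (cmod (x n t))\<^sup>2)"
      by (simp only: sum_distrib_left)
    fix n and t :: real
    assume "t \<in> {0..1}"
    then show "norm ((cmod ((a \<otimes>\<^bsub>C01\<^esub> x n) t))\<^sup>2) \<le> B\<^sup>2 * (cmod (x n t))\<^sup>2"
      using B [of t] by (auto simp: norm_mult power_mult_distrib intro!: mult_right_mono power_mono)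
  qed
qed

lemma square_summable01_zero: "square_summable01 (\<lambda>n. \<zero>\<^bsub>C01\<^esub>)"
  unfolding square_summable01_def
  by (rule uniformly_convergent_series_comparison [where g = "\<lambda>_ _. 0"])
     (auto simp: uniformly_convergent_on_const)

lemma module_l2_C01: "Module.module C01 l2_C01"
proof (rule moduleI)
  interpret C: cring C01 by (rule cring_C01)
  show "abelian_group l2_C01"
  proof (rule abelian_groupI)
    fix x
    assume x: "x \<in> carrier l2_C01"
    let ?y = "\<lambda>n. (\<ominus>\<^bsub>C01\<^esub> \<one>\<^bsub>C01\<^esub>) \<otimes>\<^bsub>C01\<^esub> x n"
    have "?y \<in> carrier l2_C01"
      using x by (auto intro: square_summable01_smult)
    moreover have "?y \<oplus>\<^bsub>l2_C01\<^esub> x = \<zero>\<^bsub>l2_C01\<^esub>"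
      using x by (auto simp: C.l_minus C.l_neg)
    ultimately show "\<exists>y\<in>carrier l2_C01. y \<oplus>\<^bsub>l2_C01\<^esub> x = \<zero>\<^bsub>l2_C01\<^esub>"
      by blast
  qed (auto simp: square_summable01_add square_summable01_zero C.a_ac)
next
  interpret C: cring C01 by (rule cring_C01)
  fix x
  assume "x \<in> carrier l2_C01"
  then show "\<one>\<^bsub>C01\<^esub> \<odot>\<^bsub>l2_C01\<^esub> x = x"
    by simp
qed (auto simp: cring_C01 square_summable01_smult square_summable01_add cring.cring_simprules [OF cring_C01])

interpretation l2_C01: Module.module C01 l2_C01
  by (rule module_l2_C01)

lemma l2_C01_uminus:
  assumes x: "x \<in> carrier l2_C01" and t: "t \<in> {0..1}"
  shows "(\<ominus>\<^bsub>l2_C01\<^esub> x) n t = - x n t"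
proof -
  have "((\<ominus>\<^bsub>l2_C01\<^esub> x) \<oplus>\<^bsub>l2_C01\<^esub> x) n t = \<zero>\<^bsub>l2_C01\<^esub> n t"
    using l2_C01.M.l_neg [OF x] by (rule arg_cong)
  then show ?thesis
    using t by (simp add: eq_neg_iff_add_eq_0)
qed

lemma l2_C01_minus:
  assumes x: "x \<in> carrier l2_C01" and y: "y \<in> carrier l2_C01" and t: "t \<in> {0..1}"
  shows "(x \<ominus>\<^bsub>l2_C01\<^esub> y) n t = x n t - y n t"
proof -
  show ?thesis
    using t l2_C01_uminus [OF y t] by (simp add: l2_C01.M.minus_eq)
qed

text \<open>
  Uniformity makes the inner product a continuous function of \<open>t\<close>.  It follows by comparison from
  \<open>\<bar>a b\<bar> \<le> \<bar>a\<bar>\<^sup>2 + \<bar>b\<bar>\<^sup>2\<close>.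
\<close>

lemma ip_series_uniformly_convergent:
  assumes x: "square_summable01 x" and y: "square_summable01 y"
  shows "uniformly_convergent_on {0..1} (\<lambda>m t. \<Sum>n<m. cnj (x n t) * y n t)"
proof (rule uniformly_convergent_series_comparison)
  have "uniformly_convergent_on {0..1}
          (\<lambda>m t. (\<Sum>n<m. (cmod (x n t))\<^sup>2) + (\<Sum>n<m. (cmod (y n t))\<^sup>2))"
    using x y unfolding square_summable01_def by (intro uniformly_convergent_add)
  then show "uniformly_convergent_on {0..1} (\<lambda>m t. \<Sum>n<m. (cmod (x n t))\<^sup>2 + (cmod (y n t))\<^sup>2)"
    by (simp only: sum.distrib)
  show "norm (cnj (x n t) * y n t) \<le> (cmod (x n t))\<^sup>2 + (cmod (y n t))\<^sup>2" for n and t :: real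
    using sum_squares_bound [of "cmod (x n t)" "cmod (y n t)"]
      mult_nonneg_nonneg [OF norm_ge_zero [of "x n t"] norm_ge_zero [of "y n t"]]
    by (simp add: norm_mult del: mult_nonneg_nonneg)
qed

lemma ip_series_summable:
  assumes "square_summable01 x" "square_summable01 y" "t \<in> {0..1}"
  shows "summable (\<lambda>n. cnj (x n t) * y n t)"
  using uniformly_convergent_imp_convergent [OF ip_series_uniformly_convergent] assms
  by (auto simp: summable_iff_convergent)

lemma norm_series_summable:
  assumes "square_summable01 x" "t \<in> {0..1}"
  shows "summable (\<lambda>n. (cmod (x n t))\<^sup>2)"
  using uniformly_convergent_imp_convergent [OF assms(1) [unfolded square_summable01_def] assms(2)]
  by (simp add: summable_iff_convergent)

lemma ip_series_self:
  assumes "square_summable01 x" "t \<in> {0..1}"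
  shows "(\<Sum>n. cnj (x n t) * x n t) = complex_of_real (\<Sum>n. (cmod (x n t))\<^sup>2)"
  using suminf_of_real [OF norm_series_summable [OF assms], where 'a = complex]
  by (simp add: complex_norm_square mult.commute del: of_real_power)

lemma ip_l2_C01_closed:
  assumes x: "x \<in> carrier l2_C01" and y: "y \<in> carrier l2_C01"
  shows "ip l2_C01 x y \<in> carrier C01"
proof -
  have "continuous_on {0..1} (\<lambda>t. \<Sum>n. cnj (x n t) * y n t)"
  proof (rule uniform_limit_theorem)
    show "uniform_limit {0..1} (\<lambda>m t. \<Sum>n<m. cnj (x n t) * y n t)
            (\<lambda>t. \<Sum>n. cnj (x n t) * y n t) sequentially"
      using x y by (intro uniform_limit_suminf ip_series_uniformly_convergent) auto
    show "\<forall>\<^sub>F m in sequentially. continuous_on {0..1} (\<lambda>t. \<Sum>n<m. cnj (x n t) * y n t)"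
      using x y by (intro always_eventually allI continuous_intros C01_continuous) auto
  qed simp
  then show ?thesis
    by (simp add: restrict_in_C01_iff)
qed

lemma pre_hilbert_l2_C01: "pre_hilbert_module l2_C01"
proof
  fix x y
  assume xy: "x \<in> carrier l2_C01" "y \<in> carrier l2_C01"
  show "ip l2_C01 x y \<in> carrier C01"
    using xy by (rule ip_l2_C01_closed)
  show "ip l2_C01 y x = star01 (ip l2_C01 x y)"
  proof (rule C01_eqI)
    show "star01 (ip l2_C01 x y) \<in> carrier C01"
      unfolding star01_def restrict_in_C01_iff
      by (intro continuous_intros C01_continuous ip_l2_C01_closed xy)
    fix t :: real assume "t \<in> {0..1}"
    then show "ip l2_C01 y x t = star01 (ip l2_C01 x y) t"
      using xy bounded_linear.suminf [OF bounded_linear_cnj ip_series_summable [of x y t]]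
      by (simp add: star01_def mult.commute)
  qed (use ip_l2_C01_closed xy in blast)
  fix z
  assume z: "z \<in> carrier l2_C01"
  show "ip l2_C01 x (y \<oplus>\<^bsub>l2_C01\<^esub> z) = ip l2_C01 x y \<oplus>\<^bsub>C01\<^esub> ip l2_C01 x z"
  proof (rule C01_eqI)
    show "ip l2_C01 x (y \<oplus>\<^bsub>l2_C01\<^esub> z) \<in> carrier C01" 
      using xy z by (intro ip_l2_C01_closed l2_C01.M.a_closed)
    show "ip l2_C01 x y \<oplus>\<^bsub>C01\<^esub> ip l2_C01 x z \<in> carrier C01"
      using xy z by (intro C01_closed ip_l2_C01_closed)
    fix t :: real assume "t \<in> {0..1}"
    then show "ip l2_C01 x (y \<oplus>\<^bsub>l2_C01\<^esub> z) t = (ip l2_C01 x y \<oplus>\<^bsub>C01\<^esub> ip l2_C01 x z) t"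
      using xy z by (simp add: suminf_add ip_series_summable ring_distribs)
  qed
next
  fix a x y
  assume axy: "a \<in> carrier C01" "x \<in> carrier l2_C01" "y \<in> carrier l2_C01"
  show "ip l2_C01 x (a \<odot>\<^bsub>l2_C01\<^esub> y) = ip l2_C01 x y \<otimes>\<^bsub>C01\<^esub> a"
  proof (rule C01_eqI)
    show "ip l2_C01 x (a \<odot>\<^bsub>l2_C01\<^esub> y) \<in> carrier C01" 
      using axy by (intro ip_l2_C01_closed l2_C01.smult_closed)
    show "ip l2_C01 x y \<otimes>\<^bsub>C01\<^esub> a \<in> carrier C01"
      using axy by (intro C01_closed ip_l2_C01_closed)
    fix t :: real assume "t \<in> {0..1}"
    then show "ip l2_C01 x (a \<odot>\<^bsub>l2_C01\<^esub> y) t = (ip l2_C01 x y \<otimes>\<^bsub>C01\<^esub> a) t"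
      using axy suminf_mult2 [OF ip_series_summable [of x y t], of "a t"]
      by (simp add: mult_ac)
  qed
next
  fix x
  assume x: "x \<in> carrier l2_C01"
  show "positive01 (ip l2_C01 x x)"
    unfolding positive01_def
    using ip_l2_C01_closed [OF x x] x
    by (auto simp: ip_series_self norm_series_summable intro!: suminf_nonneg)
  assume "ip l2_C01 x x = \<zero>\<^bsub>C01\<^esub>"
  then have ip0: "ip l2_C01 x x t = 0" if "t \<in> {0..1}" for t
    using that by (metis C01_ops(4))
  show "x = \<zero>\<^bsub>l2_C01\<^esub>"
  proof (rule l2_C01_eqI)
    fix n and t :: real
    assume t: "t \<in> {0..1}"
    then have "(\<Sum>n. (cmod (x n t))\<^sup>2) = 0"
      using ip0 [OF t] x by (simp add: ip_series_self)
    then show "x n t = \<zero>\<^bsub>l2_C01\<^esub> n t"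
      using x t suminf_eq_zero_iff [OF norm_series_summable [of x t]] by simp
  qed (use x l2_C01.M.zero_closed in auto)
qed


section \<open>Norm and completeness\<close>

text \<open>
  A supremum of sums with nonnegative terms is bounded by a number iff all partial sums are.  Hence inequalities for the
  module norm reduce to inequalities for Euclidean norms of finite sequences.
\<close>

lemma hm_norm_le_iff:
  assumes x: "x \<in> carrier l2_C01" and e: "0 \<le> e"
  shows "hm_norm l2_C01 x \<le> e \<longleftrightarrow>
    (\<forall>t\<in>{0..1}. \<forall>p. L2_set (\<lambda>n. cmod (x n t)) {..<p} \<le> e)"
proof -
  let ?s = "\<lambda>t. cmod (ip l2_C01 x x t)"
  have s: "?s t = (\<Sum>n. (cmod (x n t))\<^sup>2)" if "t \<in> {0..1}" for t
    using x that by (simp add: ip_series_self norm_series_summable suminf_nonneg)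
  have "continuous_on {0..1} ?s"
    by (intro continuous_on_norm C01_continuous ip_l2_C01_closed x)
  then have bdd: "bdd_above (?s ` {0..1})"
    by (intro bounded_imp_bdd_above compact_imp_bounded compact_continuous_image) auto
  have "hm_norm l2_C01 x \<le> e \<longleftrightarrow> (SUP t\<in>{0..1}. ?s t) \<le> e\<^sup>2"
    unfolding hm_norm_def norm01_def using e
    by (metis real_sqrt_le_iff real_sqrt_abs abs_of_nonneg)
  also have "\<dots> \<longleftrightarrow> (\<forall>t\<in>{0..1}. ?s t \<le> e\<^sup>2)"
    by (rule cSUP_le_iff [OF _ bdd]) auto
  also have "\<dots> \<longleftrightarrow> (\<forall>t\<in>{0..1}. \<forall>p. (\<Sum>n<p. (cmod (x n t))\<^sup>2) \<le> e\<^sup>2)"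
  proof (rule ball_cong [OF refl])
    fix t :: real
    assume t: "t \<in> {0..1}"
    have "summable (\<lambda>n. (cmod (x n t))\<^sup>2)"
      using x t by (simp add: norm_series_summable)
    then show "?s t \<le> e\<^sup>2 \<longleftrightarrow> (\<forall>p. (\<Sum>n<p. (cmod (x n t))\<^sup>2) \<le> e\<^sup>2)"
      unfolding s [OF t]
      by (meson order_trans suminf_le_const sum_le_suminf finite_lessThan zero_le_power2)
  qed
  also have "\<dots> \<longleftrightarrow> (\<forall>t\<in>{0..1}. \<forall>p. L2_set (\<lambda>n. cmod (x n t)) {..<p} \<le> e)"
    unfolding L2_set_def using e by (metis real_sqrt_le_iff real_sqrt_abs abs_of_nonneg)
  finally show ?thesis .
qed

lemma hm_norm_nonneg:
  assumes x: "x \<in> carrier l2_C01"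
  shows "0 \<le> hm_norm l2_C01 x"
proof -
  have "bounded (ip l2_C01 x x ` {0..1})"
    by (intro compact_imp_bounded compact_continuous_image C01_continuous ip_l2_C01_closed x) simp
  then have "bdd_above ((\<lambda>t. cmod (ip l2_C01 x x t)) ` {0..1})"
    by (meson bounded_iff bdd_above.I2 imageI)
  then have "cmod (ip l2_C01 x x 0) \<le> norm01 (ip l2_C01 x x)"
    unfolding norm01_def by (intro cSUP_upper) auto
  then show ?thesis
    unfolding hm_norm_def using norm_ge_zero order_trans by (intro real_sqrt_ge_zero) blast
qed

lemma hm_dist_le_iff:
  assumes x: "x \<in> carrier l2_C01" and y: "y \<in> carrier l2_C01" and e: "0 \<le> e"
  shows "hm_dist l2_C01 x y \<le> e \<longleftrightarrow>
    (\<forall>t\<in>{0..1}. \<forall>p. L2_set (\<lambda>n. cmod (x n t - y n t)) {..<p} \<le> e)"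
proof -
  have "hm_dist l2_C01 x y = hm_norm l2_C01 (x \<ominus>\<^bsub>l2_C01\<^esub> y)"
    using x y by (simp add: hm_dist_def)
  then show ?thesis
    using hm_norm_le_iff [OF l2_C01.M.minus_closed [OF x y] e]
    by (simp add: l2_C01_minus [OF x y])
qed

lemma hm_dist_nonneg: "0 \<le> hm_dist l2_C01 x y"
  using hm_norm_nonneg l2_C01.M.minus_closed [of x y] by (auto simp: hm_dist_def)

lemma L2_set_le_hm_dist:
  assumes "x \<in> carrier l2_C01" "y \<in> carrier l2_C01" "t \<in> {0..1}"
  shows "L2_set (\<lambda>n. cmod (x n t - y n t)) {..<p} \<le> hm_dist l2_C01 x y"
  using hm_dist_le_iff [OF assms(1,2) hm_dist_nonneg] assms(3) by blast

lemma coordinate_le_hm_dist: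
  assumes "x \<in> carrier l2_C01" "y \<in> carrier l2_C01" "t \<in> {0..1}"
  shows "cmod (x n t - y n t) \<le> hm_dist l2_C01 x y"
  using member_le_L2_set [of "{..<Suc n}" n "\<lambda>n. cmod (x n t - y n t)"]
    L2_set_le_hm_dist [OF assms, of "Suc n"] by simp

lemma L2_set_dist_triangle:
  fixes u v w :: "nat \<Rightarrow> complex"
  shows "L2_set (\<lambda>n. cmod (u n - w n)) A \<le> L2_set (\<lambda>n. cmod (u n - v n)) A + L2_set (\<lambda>n. cmod (v n - w n)) A"
proof -
  have "L2_set (\<lambda>n. cmod (u n - w n)) A \<le> L2_set (\<lambda>n. cmod (u n - v n) + cmod (v n - w n)) A"
    by (intro L2_set_mono) (auto intro: norm_diff_triangle_le)
  also note L2_set_triangle_ineq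
  finally show ?thesis .
qed

lemma Metric_space_l2_C01: "Metric_space (carrier l2_C01) (hm_dist l2_C01)"
proof
  show "0 \<le> hm_dist l2_C01 x y" for x y
    by (rule hm_dist_nonneg)
next
  fix x y
  have "hm_dist l2_C01 x y \<le> hm_dist l2_C01 y x"
    if "x \<in> carrier l2_C01" "y \<in> carrier l2_C01" for x y
    using hm_dist_le_iff [OF that hm_dist_nonneg, of y x] L2_set_le_hm_dist [OF that(2,1)]
    by (simp add: norm_minus_commute)
  then show "hm_dist l2_C01 x y = hm_dist l2_C01 y x"
    by (cases "x \<in> carrier l2_C01 \<and> y \<in> carrier l2_C01") (auto simp: hm_dist_def intro: antisym)
next
  fix x y
  assume x: "x \<in> carrier l2_C01" and y: "y \<in> carrier l2_C01"
  have "x = y" if "hm_dist l2_C01 x y = 0"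
  proof (rule l2_C01_eqI [OF x y])
    show "x n t = y n t" if "t \<in> {0..1}" for n t
      using coordinate_le_hm_dist [OF x y that, of n] \<open>hm_dist l2_C01 x y = 0\<close> by simp
  qed
  moreover have "hm_dist l2_C01 x x = 0"
    using hm_dist_le_iff [OF x x order_refl] hm_dist_nonneg [of x x] by (auto simp: L2_set_0')
  ultimately show "hm_dist l2_C01 x y = 0 \<longleftrightarrow> x = y"
    by auto
next
  fix x y z
  assume x: "x \<in> carrier l2_C01" and y: "y \<in> carrier l2_C01" and z: "z \<in> carrier l2_C01"
  have "L2_set (\<lambda>n. cmod (x n t - z n t)) {..<p} \<le> hm_dist l2_C01 x y + hm_dist l2_C01 y z"
    if "t \<in> {0..1}" for t p
    using L2_set_dist_triangle [of "\<lambda>n. x n t" "\<lambda>n. z n t" "{..<p}" "\<lambda>n. y n t"]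
      L2_set_le_hm_dist [OF x y that, of p] L2_set_le_hm_dist [OF y z that, of p] by linarith
  then show "hm_dist l2_C01 x z \<le> hm_dist l2_C01 x y + hm_dist l2_C01 y z"
    using hm_dist_le_iff [OF x z] hm_dist_nonneg by simp
qed

interpretation l2_metric: Metric_space "carrier l2_C01" "hm_dist l2_C01"
  by (rule Metric_space_l2_C01)

text \<open>
  Each coordinate of a Cauchy sequence converges uniformly on \<open>[0,1]\<close> because the norm dominates
  coordinates.  The Cauchy estimate for finitely many coordinates passes to the limit in its second
  index, with a bound that is independent of the point and of the number of coordinates.  This bound
  shows both that the limit is square summable and that it is approached in norm.
\<close>

lemma mcomplete_l2_C01: "l2_metric.mcomplete"
  unfolding l2_metric.mcomplete_def
proof (intro allI impI)
  fix \<sigma>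
  assume cauchy: "l2_metric.MCauchy \<sigma>"
  then have \<sigma>: "\<sigma> k \<in> carrier l2_C01" for k
    unfolding l2_metric.MCauchy_def by blast
  have cauchyD: "\<exists>k0. \<forall>k\<ge>k0. \<forall>l\<ge>k0. hm_dist l2_C01 (\<sigma> k) (\<sigma> l) < e" if "e > 0" for e
    using conjunct2 [OF cauchy [unfolded l2_metric.MCauchy_def], rule_format, OF that] by simp
  have "uniformly_Cauchy_on {0..1} (\<lambda>k. \<sigma> k n)" for n
  proof (rule uniformly_Cauchy_onI)
    fix e :: real
    assume "e > 0"
    then obtain k0 where k0: "\<forall>k\<ge>k0. \<forall>l\<ge>k0. hm_dist l2_C01 (\<sigma> k) (\<sigma> l) < e"
      using cauchyD by blast
    have "dist (\<sigma> k n t) (\<sigma> l n t) < e" if "t \<in> {0..1}" "k \<ge> k0" "l \<ge> k0" for t k l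
      unfolding dist_norm
      by (rule le_less_trans [OF coordinate_le_hm_dist [OF \<sigma> \<sigma>]]) (use k0 that in auto)
    then show "\<exists>k0. \<forall>t\<in>{0..1}. \<forall>k\<ge>k0. \<forall>l\<ge>k0. dist (\<sigma> k n t) (\<sigma> l n t) < e"
      by blast
  qed
  then have "\<forall>n. \<exists>f. uniform_limit {0..1} (\<lambda>k. \<sigma> k n) f sequentially"
    using uniformly_convergent_eq_Cauchy uniformly_convergent_on_def by metis
  then obtain y where y: "\<And>n. uniform_limit {0..1} (\<lambda>k. \<sigma> k n) (y n) sequentially"
    by metis
  define x where "x n = restrict (y n) {0..1}" for n
  have x_C01: "x n \<in> carrier C01" for n
  proof -
    have "continuous_on {0..1} (y n)"
      using \<sigma> by (intro uniform_limit_theorem [OF _ y] always_eventually allI C01_continuous) auto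
    then show ?thesis
      by (simp add: x_def restrict_in_C01_iff)
  qed
  have lim: "(\<lambda>k. \<sigma> k n t) \<longlonglongrightarrow> x n t" if "t \<in> {0..1}" for n t
    using tendsto_uniform_limitI [OF y that] that by (simp add: x_def)
  have close: "\<exists>k0. \<forall>k\<ge>k0. \<forall>t\<in>{0..1}. \<forall>p. L2_set (\<lambda>n. cmod (\<sigma> k n t - x n t)) {..<p} \<le> e"
    if e: "e > 0" for e
  proof -
    obtain k0 where k0: "\<forall>k\<ge>k0. \<forall>l\<ge>k0. hm_dist l2_C01 (\<sigma> k) (\<sigma> l) < e"
      using cauchyD e by blast
    have "L2_set (\<lambda>n. cmod (\<sigma> k n t - x n t)) {..<p} \<le> e" if k: "k \<ge> k0" and t: "t \<in> {0..1}" for k t p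
    proof (rule Lim_bounded)
      show "(\<lambda>l. L2_set (\<lambda>n. cmod (\<sigma> k n t - \<sigma> l n t)) {..<p})
          \<longlonglongrightarrow> L2_set (\<lambda>n. cmod (\<sigma> k n t - x n t)) {..<p}"
        unfolding L2_set_def by (intro tendsto_intros lim t)
      show "\<forall>l\<ge>k0. L2_set (\<lambda>n. cmod (\<sigma> k n t - \<sigma> l n t)) {..<p} \<le> e"
        using k0 k order_trans [OF L2_set_le_hm_dist [OF \<sigma> \<sigma> t] less_imp_le] by blast
    qed
    then show ?thesis
      by blast
  qed
  have "square_summable01 x"
    unfolding square_summable01_def uniformly_convergent_series_iff_tails
  proof (intro allI impI)
    fix e :: real
    assume e: "e > 0"
    \<comment> \<open>Both the distance to \<open>\<sigma> k\<close> and the tail of \<open>\<sigma> k\<close> get half of the Euclidean bound \<open>sqrt e\<close>.\<close>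
    define r where "r = sqrt e / 2"
    have r: "r > 0" "(2 * r)\<^sup>2 = e"
      using e by (simp_all add: r_def)
    obtain k where k: "\<And>t p. t \<in> {0..1} \<Longrightarrow> L2_set (\<lambda>n. cmod (\<sigma> k n t - x n t)) {..<p} \<le> r"
      using close [OF r(1)] by blast
    have "square_summable01 (\<sigma> k)"
      using \<sigma> [of k] by simp
    moreover have "r\<^sup>2 > 0"
      using r(1) by simp
    ultimately obtain m0 where m0: "\<And>t m p. \<lbrakk>t \<in> {0..1}; m \<ge> m0\<rbrakk> \<Longrightarrow>
        norm (\<Sum>n\<in>{m..<p}. (cmod (\<sigma> k n t))\<^sup>2) < r\<^sup>2"
      unfolding square_summable01_def uniformly_convergent_series_iff_tails by meson
    have "norm (\<Sum>n\<in>{m..<p}. (cmod (x n t))\<^sup>2) < e" if t: "t \<in> {0..1}" and m: "m \<ge> m0" for t m p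
    proof -
      have "L2_set (\<lambda>n. cmod (x n t)) {m..<p}
          \<le> L2_set (\<lambda>n. cmod (x n t - \<sigma> k n t)) {m..<p} + L2_set (\<lambda>n. cmod (\<sigma> k n t)) {m..<p}"
        using L2_set_dist_triangle [of "\<lambda>n. x n t" "\<lambda>n. 0" "{m..<p}" "\<lambda>n. \<sigma> k n t"] by simp
      moreover have "L2_set (\<lambda>n. cmod (x n t - \<sigma> k n t)) {m..<p} \<le> r"
      proof -
        have "L2_set (\<lambda>n. cmod (x n t - \<sigma> k n t)) {m..<p}
            \<le> L2_set (\<lambda>n. cmod (\<sigma> k n t - x n t)) {..<p}"
          unfolding L2_set_def norm_minus_commute [of "x _ t"]
          by (intro real_sqrt_le_mono sum_mono2) auto
        also have "\<dots> \<le> r"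
          by (rule k [OF t])
        finally show ?thesis .
      qed
      moreover have "L2_set (\<lambda>n. cmod (\<sigma> k n t)) {m..<p} < r"
        using real_sqrt_less_mono [OF m0 [OF t m, of p]] r(1) unfolding L2_set_def
        by (simp add: sum_nonneg)
      ultimately have "L2_set (\<lambda>n. cmod (x n t)) {m..<p} < 2 * r"
        by linarith
      then have "(L2_set (\<lambda>n. cmod (x n t)) {m..<p})\<^sup>2 < (2 * r)\<^sup>2"
        by (intro power_strict_mono) auto
      then show ?thesis
        by (simp only: r(2)) (simp add: L2_set_def sum_nonneg)
    qed
    then show "\<exists>m0. \<forall>t\<in>{0..1}. \<forall>m\<ge>m0. \<forall>p. norm (\<Sum>n\<in>{m..<p}. (cmod (x n t))\<^sup>2) < e"
      by blast
  qed
  with x_C01 have x: "x \<in> carrier l2_C01"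
    by simp
  have "limitin l2_metric.mtopology \<sigma> x sequentially"
    unfolding l2_metric.limitin_metric
  proof (intro conjI x allI impI)
    fix e :: real
    assume "e > 0"
    then obtain k0 where "\<forall>k\<ge>k0. \<forall>t\<in>{0..1}. \<forall>p. L2_set (\<lambda>n. cmod (\<sigma> k n t - x n t)) {..<p} \<le> e / 2"
      using close [of "e / 2"] by auto
    then have "hm_dist l2_C01 (\<sigma> k) x < e" if "k \<ge> k0" for k
      using hm_dist_le_iff [OF \<sigma> x, of "e / 2" k] \<open>e > 0\<close> that by force
    then show "\<forall>\<^sub>F k in sequentially. \<sigma> k \<in> carrier l2_C01 \<and> hm_dist l2_C01 (\<sigma> k) x < e"
      using \<sigma> unfolding eventually_sequentially by blast
  qed
  then show "\<exists>x. limitin l2_metric.mtopology \<sigma> x sequentially"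
    by blast
qed

lemma hilbert_l2_C01: "hilbert_module l2_C01"
  by (intro hilbert_module.intro hilbert_module_axioms.intro pre_hilbert_l2_C01 mcomplete_l2_C01)


section \<open>Submodules given by pointwise proportionality constraints\<close>

text \<open>
  A triple \<open>(n, t, c)\<close> forces the vector \<open>x(t)\<close> in the fibre over \<open>t\<close> into the subspace
  \<open>x\<^sub>n = c x\<^sub>0\<close>.  For \<open>n = 0\<close> and \<open>c = 0\<close> the constraint says \<open>x\<^sub>0(t) = 0\<close>, so this one form of
  constraint covers both submodules of the counterexample.
\<close>

definition constrained :: "(nat \<times> real \<times> complex) set \<Rightarrow> (nat \<Rightarrow> real \<Rightarrow> complex) set" where
  "constrained S = {x \<in> carrier l2_C01. \<forall>(n, t, c)\<in>S. x n t = c * x 0 t}"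

lemma constrained_iff:
  "x \<in> constrained S \<longleftrightarrow>
     x \<in> carrier l2_C01 \<and> (\<forall>n t c. (n, t, c) \<in> S \<longrightarrow> x n t = c * x 0 t)"
  by (auto simp: constrained_def)

text \<open>
  The equations are homogeneous and each concerns a single point, so they are preserved by the module
  operations.  They are preserved by limits because norm convergence implies convergence of every
  coordinate at every point.
\<close>

lemma closed_submodule_constrained:
  assumes S: "\<And>n t c. (n, t, c) \<in> S \<Longrightarrow> t \<in> {0..1}"
  shows "closed_submodule (constrained S) l2_C01"
  unfolding closed_submodule_def
proof
  show "submodule (constrained S) C01 l2_C01"
  proof (rule l2_C01.submoduleI)
    show "constrained S \<subseteq> carrier l2_C01"
      by (simp only: constrained_def) blast
  next
    show "\<zero>\<^bsub>l2_C01\<^esub> \<in> constrained S"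
      unfolding constrained_iff using l2_C01.M.zero_closed S by simp
  next
    fix x
    assume "x \<in> constrained S"
    then have x: "x \<in> carrier l2_C01" "\<And>n t c. (n, t, c) \<in> S \<Longrightarrow> x n t = c * x 0 t"
      unfolding constrained_iff by blast+
    have "(\<ominus>\<^bsub>l2_C01\<^esub> x) n t = c * (\<ominus>\<^bsub>l2_C01\<^esub> x) 0 t" if "(n, t, c) \<in> S" for n t c
      using x(2) [OF that] by (simp only: l2_C01_uminus [OF x(1) S [OF that]]) simp
    then show "\<ominus>\<^bsub>l2_C01\<^esub> x \<in> constrained S"
      unfolding constrained_iff using l2_C01.M.a_inv_closed [OF x(1)] by blast
  next
    fix x y
    assume "x \<in> constrained S" "y \<in> constrained S"
    then have x: "x \<in> carrier l2_C01" "\<And>n t c. (n, t, c) \<in> S \<Longrightarrow> x n t = c * x 0 t"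
      and y: "y \<in> carrier l2_C01" "\<And>n t c. (n, t, c) \<in> S \<Longrightarrow> y n t = c * y 0 t"
      unfolding constrained_iff by blast+
    have "(x \<oplus>\<^bsub>l2_C01\<^esub> y) n t = c * (x \<oplus>\<^bsub>l2_C01\<^esub> y) 0 t" if "(n, t, c) \<in> S" for n t c
      using x(2) [OF that] y(2) [OF that] S [OF that] by (simp add: ring_distribs)
    then show "x \<oplus>\<^bsub>l2_C01\<^esub> y \<in> constrained S"
      unfolding constrained_iff using l2_C01.M.a_closed [OF x(1) y(1)] by blast
  next
    fix a x
    assume a: "a \<in> carrier C01" and "x \<in> constrained S"
    then have x: "x \<in> carrier l2_C01" "\<And>n t c. (n, t, c) \<in> S \<Longrightarrow> x n t = c * x 0 t"
      unfolding constrained_iff by blast+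
    have "(a \<odot>\<^bsub>l2_C01\<^esub> x) n t = c * (a \<odot>\<^bsub>l2_C01\<^esub> x) 0 t" if "(n, t, c) \<in> S" for n t c
      using x(2) [OF that] S [OF that] by simp
    then show "a \<odot>\<^bsub>l2_C01\<^esub> x \<in> constrained S"
      unfolding constrained_iff using l2_C01.smult_closed [OF a x(1)] by blast
  qed
  show "closedin (hm_topology l2_C01) (constrained S)"
    unfolding hm_topology_def l2_metric.metric_closedin_iff_sequentially_closed
  proof (intro conjI allI impI)
    fix \<sigma> x
    assume "range \<sigma> \<subseteq> constrained S \<and> limitin l2_metric.mtopology \<sigma> x sequentially"
    then have \<sigma>S: "\<sigma> k \<in> constrained S" and lim: "limitin l2_metric.mtopology \<sigma> x sequentially" for k
      by auto
    have \<sigma>: "\<sigma> k \<in> carrier l2_C01" for k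
      using \<sigma>S by (simp add: constrained_def)
    have x: "x \<in> carrier l2_C01"
      using lim by (simp add: l2_metric.limitin_metric)
    have coord: "(\<lambda>k. \<sigma> k n t) \<longlonglongrightarrow> x n t" if t: "t \<in> {0..1}" for n t
    proof (rule tendstoI)
      fix e :: real
      assume "e > 0"
      then have "\<forall>\<^sub>F k in sequentially. hm_dist l2_C01 (\<sigma> k) x < e"
        using lim unfolding l2_metric.limitin_metric by (auto elim: eventually_mono)
      then show "\<forall>\<^sub>F k in sequentially. dist (\<sigma> k n t) (x n t) < e"
        unfolding dist_norm
        by (rule eventually_mono) (rule le_less_trans [OF coordinate_le_hm_dist [OF \<sigma> x t]])
    qed
    have "x n t = c * x 0 t" if "(n, t, c) \<in> S" for n t c
    proof (rule LIMSEQ_unique)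
      show "(\<lambda>k. \<sigma> k n t) \<longlonglongrightarrow> x n t"
        by (rule coord [OF S [OF that]])
      have "\<sigma> k n t = c * \<sigma> k 0 t" for k
        using \<sigma>S [of k] that by (auto simp: constrained_def)
      then show "(\<lambda>k. \<sigma> k n t) \<longlonglongrightarrow> c * x 0 t"
        by (simp only:) (intro tendsto_intros coord S [OF that])
    qed
    with x show "x \<in> constrained S"
      by (auto simp: constrained_def)
  qed (auto simp: constrained_def)
qed


section \<open>Thickness\<close>

lemma C01_zero_if_zero_on_dense:
  assumes f: "f \<in> carrier C01" and T: "{0..1} \<subseteq> closure T" "T \<subseteq> {0..1}"
    and zero: "\<And>t. t \<in> T \<Longrightarrow> f t = 0"
  shows "f = \<zero>\<^bsub>C01\<^esub>"
proof (rule C01_eqI [OF f C01_closed(4)])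
  fix t :: real
  assume t: "t \<in> {0..1}"
  have closure: "closure T = {0..1}"
    using T closure_minimal [OF T(2)] by auto
  have "f t = 0"
    by (rule continuous_constant_on_closure [of T f]) (use f t zero in \<open>auto simp: closure C01_continuous\<close>)
  then show "f t = \<zero>\<^bsub>C01\<^esub> t"
    using t by simp
qed

definition single :: "nat \<Rightarrow> (real \<Rightarrow> complex) \<Rightarrow> nat \<Rightarrow> real \<Rightarrow> complex" where
  "single n f = (\<lambda>m. if m = n then f else \<zero>\<^bsub>C01\<^esub>)"

lemma ip_one_term:
  assumes "\<And>m. m \<noteq> n \<Longrightarrow> cnj (h m t) * y m t = 0" and "t \<in> {0..1}"
  shows "ip l2_C01 h y t = cnj (h n t) * y n t"
  using assms suminf_finite [of "{n}" "\<lambda>m. cnj (h m t) * y m t"] by simp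

lemma single_in_l2_C01:
  assumes f: "f \<in> carrier C01"
  shows "single n f \<in> carrier l2_C01"
proof -
  have "square_summable01 (single n f)"
    unfolding square_summable01_def uniformly_convergent_series_iff_tails
  proof (intro allI impI exI ballI)
    fix e t :: real and m p
    assume "e > 0" "t \<in> {0..1}" "m \<ge> Suc n"
    then have "(\<Sum>k\<in>{m..<p}. (cmod (single n f k t))\<^sup>2) = 0"
      by (intro sum.neutral) (auto simp: single_def)
    then show "norm (\<Sum>k\<in>{m..<p}. (cmod (single n f k t))\<^sup>2) < e"
      using \<open>e > 0\<close> by simp
  qed
  with f show ?thesis
    by (simp add: single_def)
qed

text \<open>
  Testing against \<open>s \<mapsto> s - q\<close> in coordinate \<open>n\<close> gives \<open>h n = 0\<close> off \<open>q\<close>, and since \<open>q\<close> is not isolated, continuity gives \<open>h n = 0\<close> at \<open>q\<close> as well.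
\<close>

lemma coordinate_zero_if_orthogonal:
  assumes h: "h \<in> carrier l2_C01" and q: "q \<in> {0..1}"
    and orth: "\<And>f. \<lbrakk>f \<in> carrier C01; f q = 0\<rbrakk> \<Longrightarrow> ip l2_C01 h (single n f) = \<zero>\<^bsub>C01\<^esub>"
  shows "h n = \<zero>\<^bsub>C01\<^esub>"
proof (rule C01_zero_if_zero_on_dense)
  show "h n \<in> carrier C01"
    using h by simp
  have "closure ({0..1} - {q}) = {0..1}"
  proof
    show "closure ({0..1} - {q}) \<subseteq> {0..1}"
      by (intro closure_minimal) auto
    have "q \<in> closure ({0..1} - {q})"
      using q by (simp flip: islimpt_in_closure)
    then show "{0..1} \<subseteq> closure ({0..1} - {q})"
      using closure_subset [of "{0..1} - {q}"] by auto
  qed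
  then show "{0..1} \<subseteq> closure ({0..1} - {q})"
    by simp
  fix t
  assume t: "t \<in> {0..1} - {q}"
  define f where "f = (\<lambda>s\<in>{0..1}. complex_of_real (s - q))"
  have "f \<in> carrier C01"
    unfolding f_def restrict_in_C01_iff by (intro continuous_intros)
  moreover have "f q = 0" "f t \<noteq> 0"
    using q t by (auto simp: f_def)
  ultimately have "ip l2_C01 h (single n f) t = 0"
    using orth t by (metis C01_ops(4) DiffD1)
  moreover have "ip l2_C01 h (single n f) t = cnj (h n t) * f t"
    using ip_one_term [of n h t "single n f"] t by (simp add: single_def)
  ultimately show "h n t = 0"
    using \<open>f t \<noteq> 0\<close> by simp
qed auto

lemma zero_in_orth_compl: "\<zero>\<^bsub>l2_C01\<^esub> \<in> orth_compl X l2_C01"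
proof -
  have "ip l2_C01 \<zero>\<^bsub>l2_C01\<^esub> y = \<zero>\<^bsub>C01\<^esub>" for y
    by (auto simp: C01_def restrict_def fun_eq_iff)
  then show ?thesis
    using l2_C01.M.zero_closed unfolding orth_compl_def by blast
qed

theorem theorem5p2:
  shows "\<exists>(N :: (real \<Rightarrow> complex, nat \<Rightarrow> real \<Rightarrow> complex) ip_module) M K.
           hilbert_module N \<and> closed_submodule M N \<and> closed_submodule K N \<and> K \<subseteq> M \<and>
           thick K (restrict_module N M) \<and> thick M N \<and> \<not> thick K N"
proof -
  obtain T :: "real set" where T: "countable T" "T \<subseteq> {0..1}" "{0..1} \<subseteq> closure T"
    using separable [of "{0..1::real}"] by blast
  then have "T \<noteq> {}"
    by auto
  define q where "q = from_nat_into T"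
  have range_q: "range q = T"
    unfolding q_def by (rule range_from_nat_into [OF \<open>T \<noteq> {}\<close> T(1)])
  then have q: "q k \<in> {0..1}" for k
    using T(2) rangeI [of q k] unfolding range_q by blast
  define M where "M = constrained (range (\<lambda>k. (Suc k, q k, (1/2) ^ Suc k)))"
  define K where "K = constrained ((\<lambda>t. (0, t, 0)) ` {0..1} \<union> range (\<lambda>k. (Suc k, q k, 0)))"
  have M_iff: "x \<in> M \<longleftrightarrow> x \<in> carrier l2_C01 \<and> (\<forall>k. x (Suc k) (q k) = (1/2) ^ Suc k * x 0 (q k))" for x
    by (auto simp: M_def constrained_def)
  have K_iff: "x \<in> K \<longleftrightarrow> x \<in> carrier l2_C01 \<and> (\<forall>t\<in>{0..1}. x 0 t = 0) \<and> (\<forall>k. x (Suc k) (q k) = 0)" for x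
    by (simp add: K_def constrained_def ball_Un)
  have closed: "closed_submodule M l2_C01" "closed_submodule K l2_C01"
    unfolding M_def K_def using q by (auto intro!: closed_submodule_constrained)
  have "K \<subseteq> M"
    using q by (auto simp: M_iff K_iff)
  have zero_M: "\<zero>\<^bsub>l2_C01\<^esub> \<in> M"
    using q l2_C01.M.zero_closed by (simp add: M_iff)
  have single_K: "single (Suc k) f \<in> K" if "f \<in> carrier C01" "f (q k) = 0" for k f
    using that q single_in_l2_C01 [OF that(1), of "Suc k"] by (auto simp: K_iff single_def)
  have K_orth: "h (Suc k) = \<zero>\<^bsub>C01\<^esub>" if "h \<in> orth_compl K l2_C01" for h k
  proof (rule coordinate_zero_if_orthogonal)
    show "ip l2_C01 h (single (Suc k) f) = \<zero>\<^bsub>C01\<^esub>" if "f \<in> carrier C01" "f (q k) = 0" for f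
      using single_K [OF that] \<open>h \<in> orth_compl K l2_C01\<close> unfolding orth_compl_def by blast
  qed (use that q in \<open>auto simp: orth_compl_def\<close>)

  have "thick K (restrict_module l2_C01 M)"
  proof -
    have zero: "h = \<zero>\<^bsub>l2_C01\<^esub>" if M: "h \<in> M" and K: "h \<in> orth_compl K l2_C01" for h
    proof -
      have "h 0 (q k) = 0" for k
      proof -
        have "h (Suc k) (q k) = (1/2) ^ Suc k * h 0 (q k)"
          using M unfolding M_iff by blast
        then show ?thesis
          using K_orth [OF K, of k] q [of k] by simp
      qed
      then have "h 0 = \<zero>\<^bsub>C01\<^esub>"
        using M T range_q by (intro C01_zero_if_zero_on_dense [of _ T]) (auto simp: M_iff)
      then have "h n = \<zero>\<^bsub>C01\<^esub>" for n
        using K_orth [OF K] by (cases n) auto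
      then show ?thesis
        by (auto simp: fun_eq_iff)
    qed
    have "orth_compl K (restrict_module l2_C01 M) = M \<inter> orth_compl K l2_C01"
      by (auto simp: orth_compl_def restrict_module_def M_iff)
    also have "\<dots> = {\<zero>\<^bsub>l2_C01\<^esub>}"
    proof (intro equalityI subsetI)
      fix h
      assume "h \<in> M \<inter> orth_compl K l2_C01"
      then show "h \<in> {\<zero>\<^bsub>l2_C01\<^esub>}"
        unfolding singleton_iff by (elim IntE) (rule zero)
    next
      fix h
      assume "h \<in> {\<zero>\<^bsub>l2_C01\<^esub>}"
      then have "h = \<zero>\<^bsub>l2_C01\<^esub>"
        by (rule singletonD)
      then show "h \<in> M \<inter> orth_compl K l2_C01"
        by (simp only: IntI zero_M zero_in_orth_compl)
    qed
    also have "\<dots> = {\<zero>\<^bsub>restrict_module l2_C01 M\<^esub>}"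
      by (simp add: restrict_module_def)
    finally show ?thesis
      unfolding thick_def .
  qed

  moreover have "thick M l2_C01"
    unfolding thick_def
  proof (intro equalityI subsetI)
    fix h
    assume h: "h \<in> orth_compl M l2_C01"
    then have "h \<in> orth_compl K l2_C01"
      using \<open>K \<subseteq> M\<close> by (auto simp: orth_compl_def)
    note Suc = K_orth [OF this]
    \<comment> \<open>The remaining coordinate is tested against an element of \<open>M\<close> with constant coordinates.\<close>
    define v :: "nat \<Rightarrow> real \<Rightarrow> complex" where "v n = (\<lambda>t\<in>{0..1}. (1/2) ^ n)" for n
    have "square_summable01 v"
      unfolding square_summable01_def
    proof (rule Weierstrass_m_test')
      show "norm ((cmod (v n t))\<^sup>2) \<le> (1/4) ^ n" if "t \<in> {0..1}" for n t
        using that by (simp add: v_def norm_power norm_divide power2_eq_square flip: power_mult_distrib)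
    qed (simp add: summable_geometric)
    then have "v \<in> M"
      using q by (auto simp: M_iff v_def restrict_in_C01_iff)
    then have ip0: "ip l2_C01 h v = \<zero>\<^bsub>C01\<^esub>"
      using h by (simp only: orth_compl_def) blast
    have "h 0 t = 0" if t: "t \<in> {0..1}" for t
    proof -
      have "cnj (h m t) * v m t = 0" if "m \<noteq> 0" for m
        using that Suc t by (cases m) auto
      then have "ip l2_C01 h v t = cnj (h 0 t) * v 0 t"
        by (rule ip_one_term) (use t in auto)
      then show ?thesis
        using ip0 t by (simp only: C01_ops(4)) (simp add: v_def)
    qed
    then have "h n t = 0" if "t \<in> {0..1}" for n t
      using that Suc by (cases n) auto
    then have "h = \<zero>\<^bsub>l2_C01\<^esub>"
      using h l2_C01.M.zero_closed by (intro l2_C01_eqI) (auto simp: orth_compl_def)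
    then show "h \<in> {\<zero>\<^bsub>l2_C01\<^esub>}"
      by simp
  qed (use zero_in_orth_compl [of M] in blast)

  moreover have "\<not> thick K l2_C01"
  proof -
    \<comment> \<open>Every element of \<open>K\<close> has vanishing coordinate 0.\<close>
    let ?e = "single 0 \<one>\<^bsub>C01\<^esub>"
    have "ip l2_C01 ?e x = \<zero>\<^bsub>C01\<^esub>" if x: "x \<in> K" for x
    proof (rule C01_eqI)
      show "ip l2_C01 ?e x \<in> carrier C01"
        using x by (intro ip_l2_C01_closed single_in_l2_C01) (auto simp: K_iff)
      fix t :: real
      assume t: "t \<in> {0..1}"
      have "ip l2_C01 ?e x t = cnj (?e 0 t) * x 0 t"
        by (rule ip_one_term) (use t in \<open>auto simp: single_def\<close>)
      then show "ip l2_C01 ?e x t = \<zero>\<^bsub>C01\<^esub> t"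
        using x t by (simp only: K_iff) simp
    qed simp
    then have "?e \<in> orth_compl K l2_C01"
      using single_in_l2_C01 [OF C01_closed(3), of 0] by (simp only: orth_compl_def) blast
    moreover have "?e 0 0 \<noteq> \<zero>\<^bsub>l2_C01\<^esub> 0 0"
      by (simp add: single_def)
    ultimately show ?thesis
      unfolding thick_def by (metis singletonD)
  qed

  ultimately show ?thesis
    using hilbert_l2_C01 closed \<open>K \<subseteq> M\<close> by blast
qed

end
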